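(* Assume $A$ is associative. Let $\Omega$ be a $T$-slice domain in $V$ and let $f:\Omega\to A$ be $T$-regular. If the function $\|f\|:\Omega\to\mathbb{R}$ has a global maximum point in $\Omega$, then $f$ is constant in $\Omega$.
   Context: $\mathbb{N}$ includes $0$. $A$ is a finite-dimensional alternative (unital) real $*$-algebra: a finite-dimensional real vector space with an $\mathbb{R}$-bilinear multiplication such that $x(xy)=x^2y$, $(xy)y=xy^2$ (automatic if $A$ is associative), and with an involutive real-linear antiautomorphism $x\mapsto x^c$; $\mathbb{R}$ is identified with $\mathbb{R}1$. Set $t(x)=x+x^c$, $n(x)=xx^c$, $\mathbb{S}_A=\{x\in A:t(x)=0,\ n(x)=1\}$, assumed nonempty. Let $Q_A=\bigcup_{J\in\mathbb{S}_A}(\mathbb{R}+J\mathbb{R})$. A hypercomplex subspace of $A$ is a real vector subspace $V$ with $\mathbb{R}\subsetneq V\subseteq Q_A$; a hypercomplex basis of $V$ is an ordered real basis $(v_0,\ldots,v_n)$ with $n\ge1$, $v_0=1$, $v_s\in\mathbb{S}_A$ and $v_sv_u=-v_uv_s$ for distinct $s,u\in\{1,\ldots,n\}$. Setting. $V$ is a hypercomplex subspace of $A$ with hypercomplex basis $\mathcal{B}=(v_0,\ldots,v_n)$, completed to a real basis $\mathcal{B}'=(v_0,\ldots,v_d)$ of $A$; $\langle\cdot,\cdot\rangle$ and $\|\cdot\|$ are the Euclidean scalar product and norm on $A$ making $\mathcal{B}'$ orthonormal. A domain is a nonempty connected open subset. Fix $\tau\in\{0,\ldots,n\}$ and a list of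 steps $T=(t_0,\ldots,t_\tau)\in\mathbb{N}^{\tau+1}$ with $0\le t_0<t_1<\cdots<t_\tau=n$. For $0\le\ell\le m\le n$, $\mathbb{R}_{\ell,m}=\mathrm{Span}(v_\ell,\ldots,v_m)$ and $\mathbb{S}_{\ell,m}$ is its unit sphere. The mirror is $\mathbb{R}_{0,t_0}$; the $T$-torus is $\mathbb{T}=\mathbb{S}_{t_0+1,t_1}\times\cdots\times\mathbb{S}_{t_{\tau-1}+1,t_\tau}$ if $\tau\ge1$. For $J=(J_1,\ldots,J_\tau)\in\mathbb{T}$, $\mathcal{B}_J=(v_0,v_1,\ldots,v_{t_0},J_1,\ldots,J_\tau)$ and $\mathbb{R}_J^{t_0+\tau+1}=\mathrm{Span}(\mathcal{B}_J)$, with elements written $x_0+v_1x_1+\cdots+v_{t_0}x_{t_0}+\beta_1J_1+\cdots+\beta_\tau J_\tau$. If $\tau=0$, "$J\in\mathbb{T}$" is read as $J=\emptyset$, with $\mathcal{B}_\emptyset=\mathcal{B}$ and $\mathbb{R}_\emptyset^{t_0+1}=V$. For $Y\subseteq V$ and $f:Y\to A$: $Y_J=Y\cap\mathbb{R}_J^{t_0+\tau+1}$ and $f_J=f|_{Y_J}$. A function $f:\Omega\to A$ on a domain $\Omega\subseteq V$ is $T$-regular if for every $J\in\mathbb{T}$ the restriction $f_J$ is $J$-monogenic, i.e. of class $\mathscr{C}^1$ on the open subset $\Omega_J$ of $\mathbb{R}_J^{t_0+\tau+1}$ with $(\partial_{x_0}+v_1\partial_{x_1}+\cdots+v_{t_0}\partial_{x_{t_0}}+J_1\partial_{\beta_1}+\cdots+J_\tau\partial_{\beta_\tau})f_J\equiv0$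 (vacuous if $\Omega_J=\emptyset$). A domain $\Omega\subseteq V$ is a $T$-slice domain if it intersects the mirror $\mathbb{R}_{0,t_0}$ and if, for every $J\in\mathbb{T}$, the slice $\Omega_J$ is connected. *)

theory Defs
  imports "HOL-Analysis.Analysis"
begin

text \<open>
  The algebra $A$ is a type of sort \<open>{euclidean_space, real_algebra_1}\<close>. The class
  \<open>real_algebra_1\<close> provides an associative unital real algebra (nontrivial, so that the reals
  embed), and \<open>euclidean_space\<close> provides finite dimension together with a Euclidean scalar
  product. No compatibility between norm and multiplication is implied by this sort. The scalar
  product is tied to the hypercomplex basis by \<open>orthonormal_family\<close> below, applied to
  the completed basis $(v_0,\ldots,v_d)$ of $A$, which determines it.

  Ordered bases $(v_0,\ldots,v_m)$ are functions on \<open>nat\<close>; only the values at indices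
  at most $m$ matter.
\<close>

definition star_involution :: "('a::real_algebra_1 \<Rightarrow> 'a) \<Rightarrow> bool" where
  "star_involution star \<longleftrightarrow>
     linear star \<and> (\<forall>x. star (star x) = x) \<and> (\<forall>x y. star (x * y) = star y * star x)"

definition trace_A :: "('a::real_algebra_1 \<Rightarrow> 'a) \<Rightarrow> 'a \<Rightarrow> 'a" where
  "trace_A star x = x + star x"

definition norm_A :: "('a::real_algebra_1 \<Rightarrow> 'a) \<Rightarrow> 'a \<Rightarrow> 'a" where
  "norm_A star x = x * star x"

definition imag_units :: "('a::real_algebra_1 \<Rightarrow> 'a) \<Rightarrow> 'a set" where
  "imag_units star = {x. trace_A star x = 0 \<and> norm_A star x = 1}"

definition quadratic_cone :: "('a::real_algebra_1 \<Rightarrow> 'a) \<Rightarrow> 'a set" where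
  "quadratic_cone star =
     (\<Union>J\<in>imag_units star. {of_real a + J * of_real b | a b. True})"

definition hypercomplex_subspace :: "('a::real_algebra_1 \<Rightarrow> 'a) \<Rightarrow> 'a set \<Rightarrow> bool" where
  "hypercomplex_subspace star V \<longleftrightarrow>
     subspace V \<and> \<real> \<subset> V \<and> V \<subseteq> quadratic_cone star"

definition ordered_basis :: "'a::real_vector set \<Rightarrow> nat \<Rightarrow> (nat \<Rightarrow> 'a) \<Rightarrow> bool" where
  "ordered_basis W m v \<longleftrightarrow>
     inj_on v {..m} \<and> independent (v ` {..m}) \<and> span (v ` {..m}) = W"

definition hypercomplex_basis ::
  "('a::real_algebra_1 \<Rightarrow> 'a) \<Rightarrow> 'a set \<Rightarrow> nat \<Rightarrow> (nat \<Rightarrow> 'a) \<Rightarrow> bool" where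
  "hypercomplex_basis star V n v \<longleftrightarrow>
     n \<ge> 1 \<and> ordered_basis V n v \<and> v 0 = 1 \<and>
     (\<forall>s\<in>{1..n}. v s \<in> imag_units star) \<and>
     (\<forall>s\<in>{1..n}. \<forall>u\<in>{1..n}. s \<noteq> u \<longrightarrow> v s * v u = - (v u * v s))"

definition orthonormal_family :: "nat \<Rightarrow> (nat \<Rightarrow> 'a::real_inner) \<Rightarrow> bool" where
  "orthonormal_family m v \<longleftrightarrow>
     (\<forall>i\<le>m. \<forall>j\<le>m. v i \<bullet> v j = (if i = j then 1 else 0))"

definition list_of_steps :: "nat \<Rightarrow> nat \<Rightarrow> (nat \<Rightarrow> nat) \<Rightarrow> bool" where
  "list_of_steps n \<tau> t \<longleftrightarrow> \<tau> \<le> n \<and> strict_mono_on {..\<tau>} t \<and> t \<tau> = n"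

definition coord_span :: "(nat \<Rightarrow> 'a::real_vector) \<Rightarrow> nat \<Rightarrow> nat \<Rightarrow> 'a set" where
  "coord_span v l m = span (v ` {l..m})"

definition coord_sphere :: "(nat \<Rightarrow> 'a::real_normed_vector) \<Rightarrow> nat \<Rightarrow> nat \<Rightarrow> 'a set" where
  "coord_sphere v l m = {x \<in> coord_span v l m. norm x = 1}"

definition mirror :: "(nat \<Rightarrow> 'a::real_vector) \<Rightarrow> (nat \<Rightarrow> nat) \<Rightarrow> 'a set" where
  "mirror v t = coord_span v 0 (t 0)"

text \<open>
  The tuple $(J_1,\ldots,J_\tau)$ is an extensional function on \<open>{1..\<tau>}\<close>. For $\tau = 0$
  the torus has exactly one element, the empty tuple.
\<close>

definition torus ::
  "(nat \<Rightarrow> 'a::real_normed_vector) \<Rightarrow> nat \<Rightarrow> (nat \<Rightarrow> nat) \<Rightarrow> (nat \<Rightarrow> 'a) set" where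
  "torus v \<tau> t = (\<Pi>\<^sub>E h\<in>{1..\<tau>}. coord_sphere v (t (h - 1) + 1) (t h))"

definition slice_basis ::
  "(nat \<Rightarrow> 'a) \<Rightarrow> nat \<Rightarrow> (nat \<Rightarrow> nat) \<Rightarrow> (nat \<Rightarrow> 'a) \<Rightarrow> 'a set" where
  "slice_basis v \<tau> t J = v ` {0..t 0} \<union> J ` {1..\<tau>}"

definition slice_space ::
  "(nat \<Rightarrow> 'a::real_vector) \<Rightarrow> nat \<Rightarrow> (nat \<Rightarrow> nat) \<Rightarrow> (nat \<Rightarrow> 'a) \<Rightarrow> 'a set" where
  "slice_space v \<tau> t J = span (slice_basis v \<tau> t J)"

definition slice ::
  "(nat \<Rightarrow> 'a::real_vector) \<Rightarrow> nat \<Rightarrow> (nat \<Rightarrow> nat) \<Rightarrow> 'a set \<Rightarrow> (nat \<Rightarrow> 'a) \<Rightarrow> 'a set" where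
  "slice v \<tau> t Y J = Y \<inter> slice_space v \<tau> t J"

text \<open>
  The partial derivative with respect to the coordinate along a basis vector \<open>e\<close> is the
  derivative along \<open>e\<close>. At a point of a relatively open subset \<open>Y\<close> of the span of a
  basis containing \<open>e\<close>, it depends only on the restriction of \<open>f\<close> to \<open>Y\<close>.
\<close>

definition partial_deriv ::
  "'a::real_normed_vector \<Rightarrow> ('a \<Rightarrow> 'b::real_normed_vector) \<Rightarrow> 'a \<Rightarrow> 'b" where
  "partial_deriv e f p = vector_derivative (\<lambda>s::real. f (p + s *\<^sub>R e)) (at 0)"

definition class_C1_on ::
  "'a::real_normed_vector set \<Rightarrow> ('a \<Rightarrow> 'b::real_normed_vector) \<Rightarrow> 'a set \<Rightarrow> bool" where
  "class_C1_on B f Y \<longleftrightarrow>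
     (\<forall>e\<in>B. (\<forall>p\<in>Y. (\<lambda>s::real. f (p + s *\<^sub>R e)) differentiable (at 0)) \<and>
             continuous_on Y (partial_deriv e f))"

text \<open>The summand for \<open>i = 0\<close> is the plain partial derivative, since \<open>v 0 = 1\<close>.\<close>

definition dbar ::
  "(nat \<Rightarrow> 'a::{euclidean_space, real_algebra_1}) \<Rightarrow> nat \<Rightarrow> (nat \<Rightarrow> nat) \<Rightarrow> (nat \<Rightarrow> 'a)
     \<Rightarrow> ('a \<Rightarrow> 'a) \<Rightarrow> 'a \<Rightarrow> 'a" where
  "dbar v \<tau> t J f p =
     (\<Sum>i=0..t 0. v i * partial_deriv (v i) f p) + (\<Sum>h=1..\<tau>. J h * partial_deriv (J h) f p)"

definition monogenic_on ::
  "(nat \<Rightarrow> 'a::{euclidean_space, real_algebra_1}) \<Rightarrow> nat \<Rightarrow> (nat \<Rightarrow> nat) \<Rightarrow> (nat \<Rightarrow> 'a)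
     \<Rightarrow> ('a \<Rightarrow> 'a) \<Rightarrow> 'a set \<Rightarrow> bool" where
  "monogenic_on v \<tau> t J f Y \<longleftrightarrow>
     class_C1_on (slice_basis v \<tau> t J) f Y \<and> (\<forall>p\<in>Y. dbar v \<tau> t J f p = 0)"

definition domain_in :: "'a::topological_space set \<Rightarrow> 'a set \<Rightarrow> bool" where
  "domain_in V \<Omega> \<longleftrightarrow> \<Omega> \<noteq> {} \<and> connected \<Omega> \<and> openin (top_of_set V) \<Omega>"

definition T_regular ::
  "(nat \<Rightarrow> 'a::{euclidean_space, real_algebra_1}) \<Rightarrow> nat \<Rightarrow> (nat \<Rightarrow> nat) \<Rightarrow> 'a set
     \<Rightarrow> ('a \<Rightarrow> 'a) \<Rightarrow> bool" where
  "T_regular v \<tau> t \<Omega> f \<longleftrightarrow>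
     (\<forall>J\<in>torus v \<tau> t. monogenic_on v \<tau> t J f (slice v \<tau> t \<Omega> J))"

definition T_slice_domain ::
  "'a::real_normed_vector set \<Rightarrow> (nat \<Rightarrow> 'a) \<Rightarrow> nat \<Rightarrow> (nat \<Rightarrow> nat) \<Rightarrow> 'a set \<Rightarrow> bool" where
  "T_slice_domain V v \<tau> t \<Omega> \<longleftrightarrow>
     domain_in V \<Omega> \<and> \<Omega> \<inter> mirror v t \<noteq> {} \<and>
     (\<forall>J\<in>torus v \<tau> t. connected (slice v \<tau> t \<Omega> J))"

end

theory Submission
  imports Defs
begin

text \<open>
  The proof reduces to a maximum principle on a single slice. A point $p$ where
  $\|f\|$ is maximal lies in some slice, and $f$ is constant on that slice. Every slice space contains
  the mirror, so $f$ takes the value $f(p)$ at a point of $\Omega$ in the mirror. This point is again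
  a maximum point, and it belongs to every slice; hence $f$ is equal to $f(p)$ on every slice.
  The slices cover $\Omega$ (\<open>exists_slice_through\<close>).

  On one slice, let $B$ be the orthonormal basis of the slice space. For $x,y$ in $V$ the identity
  $x^c y + y^c x = 2\langle x,y\rangle$ holds (\<open>hypercomplex_clifford\<close>), so the
  operator $\sum_{e\in B} e\,\partial_e$ factors the Laplacian. As $f$ is only $C^1$, the Laplacian
  cannot be applied to it; a mean value property is obtained directly from the
  first-order equation instead. Multiply $\sum_e e\,\partial_e f = 0$ on the left by
  $y^c = \sum_e \langle y,e\rangle e^c$. By the Clifford identity the result is the radial derivative
  $\sum_e \langle y,e\rangle\,\partial_e f$ plus a combination of the angular derivatives
  $\langle y,e\rangle\,\partial_{e'}f - \langle y,e'\rangle\,\partial_e f$. Against a radial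
  weight the angular derivatives integrate to zero, hence so does the radial derivative
  (\<open>monogenic_radial_integral_eq_0\<close>), and the weighted mean of $f$ over a ball
  does not depend on the radius (\<open>monogenic_weighted_mean\<close>). At a maximum point $p$ the
  function $\langle f(p), f(p) - f\rangle$ is nonnegative with mean zero, so it vanishes near $p$, and
  $\|f\| \le \|f(p)\|$ then forces $f = f(p)$ there. Connectedness of the slice finishes the
  argument (\<open>monogenic_maximum_principle\<close>).

  Integration takes place over the whole algebra rather than over the slice space: the
  function $f$ on a slice is replaced by $f \circ P$, where $P$ is the orthogonal projection onto the
  slice space. This leaves derivatives along $B$ unchanged and makes those orthogonal to
  $B$ vanish. Left multiplication commutes with the integral because it is a linear map on a
  finite-dimensional space.
\<close>

section \<open>Continuous partial derivatives give a total derivative\<close>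

text \<open>
  The directions in $B$ are added one at a time: moving along one further direction $b$ changes the
  error by at most $\epsilon$ times the length of the move, by the mean value inequality applied to
  $\partial_b g - \partial_b g(x)$ on the segment.
\<close>

lemma continuous_partials_linearization:
  fixes g :: "'a::real_normed_vector \<Rightarrow> 'b::real_normed_vector" and B :: "'a set"
  assumes "finite B" and U: "open U" "x \<in> U" and "\<epsilon> > 0"
    and der: "\<And>e y. e \<in> B \<Longrightarrow> y \<in> U \<Longrightarrow>
           ((\<lambda>s. g (y + s *\<^sub>R e)) has_vector_derivative d e y) (at 0)"
    and cont: "\<And>e. e \<in> B \<Longrightarrow> continuous_on U (d e)"
  shows "\<exists>\<delta>>0. \<forall>a. (\<forall>e\<in>B. \<bar>a e\<bar> < \<delta>) \<longrightarrow>
           norm (g (x + (\<Sum>e\<in>B. a e *\<^sub>R e)) - g x - (\<Sum>e\<in>B. a e *\<^sub>R d e x)) \<le> \<epsilon> * (\<Sum>e\<in>B. \<bar>a e\<bar>)"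
  using \<open>finite B\<close> der cont
proof (induction B)
  case empty
  show ?case by (auto intro: exI[of _ 1])
next
  case (insert b B)
  obtain \<delta>1 where \<delta>1: "\<delta>1 > 0" and IH: "\<And>a. \<forall>e\<in>B. \<bar>a e\<bar> < \<delta>1 \<Longrightarrow>
      norm (g (x + (\<Sum>e\<in>B. a e *\<^sub>R e)) - g x - (\<Sum>e\<in>B. a e *\<^sub>R d e x)) \<le> \<epsilon> * (\<Sum>e\<in>B. \<bar>a e\<bar>)"
    using insert.IH[OF insert.prems] by auto
  obtain \<delta>2 where \<delta>2: "\<delta>2 > 0" and near: "\<And>y. dist y x < \<delta>2 \<Longrightarrow> y \<in> U \<and> dist (d b y) (d b x) < \<epsilon>"
  proof -
    obtain r1 where r1: "r1 > 0" "ball x r1 \<subseteq> U"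
      using U openE by blast
    have "\<exists>r2>0. \<forall>y\<in>U. dist y x < r2 \<longrightarrow> dist (d b y) (d b x) < \<epsilon>"
      using insert.prems(2)[of b] U \<open>\<epsilon> > 0\<close> unfolding continuous_on_iff by blast
    then obtain r2 where r2: "r2 > 0" "\<And>y. y \<in> U \<Longrightarrow> dist y x < r2 \<Longrightarrow> dist (d b y) (d b x) < \<epsilon>"
      by blast
    show ?thesis
    proof (rule that[of "min r1 r2"])
      show "min r1 r2 > 0" using r1 r2 by simp
      show "y \<in> U \<and> dist (d b y) (d b x) < \<epsilon>" if "dist y x < min r1 r2" for y
        using that r1 r2(2)[of y] by (auto simp: dist_commute subset_eq)
    qed
  qed
  define C where "C = 1 + (\<Sum>e\<in>insert b B. norm e)"
  have C: "C > 0" unfolding C_def by (intro add_pos_nonneg sum_nonneg) auto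
  define \<delta> where "\<delta> = min \<delta>1 (\<delta>2 / C)"
  have "\<delta> > 0" using \<delta>1 \<delta>2 C by (simp add: \<delta>_def)
  have step: "norm (g (x + (\<Sum>e\<in>insert b B. a e *\<^sub>R e)) - g x - (\<Sum>e\<in>insert b B. a e *\<^sub>R d e x))
      \<le> \<epsilon> * (\<Sum>e\<in>insert b B. \<bar>a e\<bar>)" if a: "\<forall>e\<in>insert b B. \<bar>a e\<bar> < \<delta>" for a
  proof -
    define z where "z = x + (\<Sum>e\<in>B. a e *\<^sub>R e)"
    have seg: "dist (z + s *\<^sub>R b) x < \<delta>2" if "s \<in> closed_segment 0 (a b)" for s
    proof -
      have s: "\<bar>s\<bar> \<le> \<delta>"
        using that a by (auto simp: closed_segment_eq_real_ivl split: if_splits)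
      have "dist (z + s *\<^sub>R b) x = norm ((\<Sum>e\<in>B. a e *\<^sub>R e) + s *\<^sub>R b)"
        by (simp add: z_def dist_norm)
      also have "\<dots> \<le> (\<Sum>e\<in>B. norm (a e *\<^sub>R e)) + norm (s *\<^sub>R b)"
        by (intro order.trans[OF norm_triangle_ineq] add_mono norm_sum) auto
      also have "\<dots> \<le> (\<Sum>e\<in>B. \<delta> * norm e) + \<delta> * norm b"
        using a s by (intro add_mono sum_mono) (auto intro!: mult_right_mono simp: less_imp_le)
      also have "\<dots> = \<delta> * (C - 1)"
        using insert.hyps by (simp add: C_def sum_distrib_left algebra_simps)
      also have "\<dots> < \<delta> * C" using \<open>\<delta> > 0\<close> by simp
      also have "\<dots> \<le> \<delta>2" using C by (simp add: \<delta>_def min_def field_simps)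
      finally show ?thesis .
    qed
    have "norm (g (z + a b *\<^sub>R b) - g (z + 0 *\<^sub>R b) - (a b - 0) *\<^sub>R d b x) \<le> norm (a b - 0) * \<epsilon>"
    proof -
      have dv: "((\<lambda>s. g (z + s *\<^sub>R b)) has_vector_derivative d b (z + s *\<^sub>R b)) (at s within closed_segment 0 (a b))"
        if "s \<in> closed_segment 0 (a b)" for s
      proof -
        have "((\<lambda>h. g (z + s *\<^sub>R b + h *\<^sub>R b)) has_vector_derivative d b (z + s *\<^sub>R b)) (at 0)"
          using insert.prems(1)[of b] near seg[OF that] by blast
        then have "((\<lambda>h. g (z + s *\<^sub>R b + h *\<^sub>R b)) \<circ> (\<lambda>u. u - s) has_vector_derivative 1 *\<^sub>R d b (z + s *\<^sub>R b)) (at s)"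
          by (intro vector_diff_chain_at) (auto intro!: derivative_eq_intros)
        then show ?thesis
          by (auto simp: o_def algebra_simps intro: has_vector_derivative_at_within)
      qed
      have "norm ((\<lambda>s. g (z + s *\<^sub>R b) - s *\<^sub>R d b x) (a b) - (\<lambda>s. g (z + s *\<^sub>R b) - s *\<^sub>R d b x) 0) \<le> \<epsilon> * norm (a b - 0)"
      proof (rule differentiable_bound)
        show "((\<lambda>s. g (z + s *\<^sub>R b) - s *\<^sub>R d b x) has_derivative (\<lambda>h. h *\<^sub>R (d b (z + s *\<^sub>R b) - d b x)))
               (at s within closed_segment 0 (a b))" if "s \<in> closed_segment 0 (a b)" for s
          using dv[OF that] unfolding has_vector_derivative_def
          by (auto intro!: derivative_eq_intros simp: algebra_simps)
        show "onorm (\<lambda>h. h *\<^sub>R (d b (z + s *\<^sub>R b) - d b x)) \<le> \<epsilon>" if "s \<in> closed_segment 0 (a b)" for s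
          using near[OF seg[OF that]]
          by (intro onorm_le) (auto simp: dist_norm mult.commute[of \<epsilon>] intro!: mult_left_mono)
      qed auto
      then show ?thesis by (simp add: algebra_simps)
    qed
    then have 1: "norm (g (z + a b *\<^sub>R b) - g z - a b *\<^sub>R d b x) \<le> \<epsilon> * \<bar>a b\<bar>"
      by (simp add: mult.commute)
    have 2: "norm (g z - g x - (\<Sum>e\<in>B. a e *\<^sub>R d e x)) \<le> \<epsilon> * (\<Sum>e\<in>B. \<bar>a e\<bar>)"
      unfolding z_def using a by (intro IH) (auto simp: \<delta>_def)
    have "g (x + (\<Sum>e\<in>insert b B. a e *\<^sub>R e)) - g x - (\<Sum>e\<in>insert b B. a e *\<^sub>R d e x)
       = (g (z + a b *\<^sub>R b) - g z - a b *\<^sub>R d b x) + (g z - g x - (\<Sum>e\<in>B. a e *\<^sub>R d e x))"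
      using insert.hyps by (simp add: z_def algebra_simps)
    also have "norm \<dots> \<le> \<epsilon> * \<bar>a b\<bar> + \<epsilon> * (\<Sum>e\<in>B. \<bar>a e\<bar>)"
      using 1 2 norm_triangle_mono by blast
    finally show ?thesis using insert.hyps by (simp add: algebra_simps)
  qed
  then show ?case using \<open>\<delta> > 0\<close> by blast
qed

text \<open>
  The last hypothesis says that $g$ depends on the displacement from $x$ only through its coordinates
  along $B$; it makes directional derivatives along $B$ sufficient even when $B$ does
  not span the space.
\<close>

lemma has_derivative_of_continuous_partials:
  fixes g :: "'a::euclidean_space \<Rightarrow> 'b::real_normed_vector" and B :: "'a set"
  assumes B: "finite B" "\<And>e. e \<in> B \<Longrightarrow> norm e = 1"
    and U: "open U" "x \<in> U"
    and der: "\<And>e y. e \<in> B \<Longrightarrow> y \<in> U \<Longrightarrow>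
           ((\<lambda>s. g (y + s *\<^sub>R e)) has_vector_derivative d e y) (at 0)"
    and cont: "\<And>e. e \<in> B \<Longrightarrow> continuous_on U (d e)"
    and along: "\<And>h. g (x + h) = g (x + (\<Sum>e\<in>B. (h \<bullet> e) *\<^sub>R e))"
  shows "(g has_derivative (\<lambda>h. \<Sum>e\<in>B. (h \<bullet> e) *\<^sub>R d e x)) (at x)"
  unfolding has_derivative_at_alt
proof (intro conjI allI impI)
  show "bounded_linear (\<lambda>h. \<Sum>e\<in>B. (h \<bullet> e) *\<^sub>R d e x)"
    by (intro bounded_linear_intros)
next
  fix \<epsilon> :: real assume "\<epsilon> > 0"
  define \<epsilon>' where "\<epsilon>' = \<epsilon> / (real (card B) + 1)"
  have "\<epsilon>' > 0" using \<open>\<epsilon> > 0\<close> by (simp add: \<epsilon>'_def)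
  from continuous_partials_linearization[OF B(1) U this der cont]
  obtain \<delta> where "\<delta> > 0" and \<delta>: "\<And>a. \<forall>e\<in>B. \<bar>a e\<bar> < \<delta> \<Longrightarrow>
      norm (g (x + (\<Sum>e\<in>B. a e *\<^sub>R e)) - g x - (\<Sum>e\<in>B. a e *\<^sub>R d e x)) \<le> \<epsilon>' * (\<Sum>e\<in>B. \<bar>a e\<bar>)"
    by blast
  show "\<exists>\<delta>>0. \<forall>y. norm (y - x) < \<delta> \<longrightarrow>
       norm (g y - g x - (\<Sum>e\<in>B. ((y - x) \<bullet> e) *\<^sub>R d e x)) \<le> \<epsilon> * norm (y - x)"
  proof (intro exI conjI allI impI)
    fix y assume y: "norm (y - x) < \<delta>"
    have le: "\<bar>(y - x) \<bullet> e\<bar> \<le> norm (y - x)" if "e \<in> B" for e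
      using Cauchy_Schwarz_ineq2[of "y - x" e] B(2)[OF that] by simp
    have "norm (g y - g x - (\<Sum>e\<in>B. ((y - x) \<bullet> e) *\<^sub>R d e x)) \<le> \<epsilon>' * (\<Sum>e\<in>B. \<bar>(y - x) \<bullet> e\<bar>)"
      using \<delta>[of "\<lambda>e. (y - x) \<bullet> e"] along[of "y - x"] le y by (force)
    also have "\<dots> \<le> \<epsilon>' * (real (card B) * norm (y - x))"
      using \<open>\<epsilon>' > 0\<close> le by (intro mult_left_mono sum_bounded_above) auto
    also have "\<dots> \<le> \<epsilon> * norm (y - x)"
      using \<open>\<epsilon> > 0\<close> unfolding \<epsilon>'_def by (simp add: field_simps mult_left_mono)
    finally show "norm (g y - g x - (\<Sum>e\<in>B. ((y - x) \<bullet> e) *\<^sub>R d e x)) \<le> \<epsilon> * norm (y - x)" .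
  qed (rule \<open>\<delta> > 0\<close>)
qed

section \<open>Integration by parts against a radial weight\<close>

text \<open>
  Translating a function supported in the unit ball by a vector of length at most $1$ keeps its support inside the box,
  so the integral over the box does not change with the translation; differentiate this
  under the integral sign. The function needs to be defined and differentiable only on $S$, a set
  containing all the translates of the box.
\<close>

lemma integral_directional_derivative_eq_0:
  fixes H :: "'a::euclidean_space \<Rightarrow> 'b::banach"
  assumes Q: "cball 0 2 \<subseteq> cbox a b"
    and e: "norm e \<le> 1"
    and S: "\<And>y s. y \<in> cbox a b \<Longrightarrow> \<bar>s\<bar> \<le> 1 \<Longrightarrow> y + s *\<^sub>R e \<in> S"
    and der: "\<And>y. y \<in> S \<Longrightarrow> (H has_derivative H' y) (at y)"
    and cont: "continuous_on S (\<lambda>y. H' y e)"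
    and supp: "\<And>y. y \<in> S \<Longrightarrow> norm y > 1 \<Longrightarrow> H y = 0"
  shows "integral (cbox a b) (\<lambda>y. H' y e) = 0"
proof -
  have contH: "continuous_on S H"
    by (rule has_derivative_continuous_on[OF has_derivative_at_withinI[OF der]])
  have shift: "integral (cbox a b) (\<lambda>y. H (y + s *\<^sub>R e)) = integral (cball 0 1) H" if s: "\<bar>s\<bar> \<le> 1" for s
  proof -
    let ?T = "cbox (a + s *\<^sub>R e) (b + s *\<^sub>R e)"
    have TS: "y \<in> S" if "y \<in> ?T" for y
    proof -
      have "y - s *\<^sub>R e \<in> cbox a b"
        using that by (auto simp: mem_box inner_simps)
      from S[OF this s] show ?thesis by simp
    qed
    have ballT: "cball 0 1 \<subseteq> ?T"
    proof
      fix y :: 'a assume y: "y \<in> cball 0 1"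
      have "norm (y - s *\<^sub>R e) \<le> norm y + \<bar>s\<bar> * norm e"
        using norm_triangle_ineq4[of y "s *\<^sub>R e"] by simp
      also have "\<dots> \<le> 1 + 1 * 1"
        using y s e by (intro add_mono mult_mono) auto
      finally have "y - s *\<^sub>R e \<in> cbox a b" using Q by auto
      then show "y \<in> ?T" by (auto simp: mem_box inner_simps)
    qed
    have "H integrable_on ?T"
      using TS by (intro integrable_continuous continuous_on_subset[OF contH]) auto
    then have "(H has_integral integral ?T H) ?T" by (rule integrable_integral)
    then have "((H \<circ> ((+) (s *\<^sub>R e))) has_integral integral ?T H) (cbox a b)"
      by (simp only: has_integral_shift_cbox_iff)
    then have "integral (cbox a b) (\<lambda>y. H (y + s *\<^sub>R e)) = integral ?T H"
      by (simp add: o_def add.commute integral_unique)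
    also have "\<dots> = integral ?T (\<lambda>y. if y \<in> cball 0 1 then H y else 0)"
      using TS supp by (intro integral_cong) auto
    also have "\<dots> = integral (cball 0 1 \<inter> ?T) H"
      by (rule Henstock_Kurzweil_Integration.integral_restrict_Int)
    also have "cball 0 1 \<inter> ?T = cball 0 1" using ballT by auto
    finally show ?thesis .
  qed
  have "((\<lambda>s. integral (cbox a b) (\<lambda>y. H (y + s *\<^sub>R e)))
      has_vector_derivative integral (cbox a b) (\<lambda>y. H' (y + 0 *\<^sub>R e) e)) (at 0 within {-1..1})"
  proof (rule leibniz_rule_vector_derivative)
    show "((\<lambda>s. H (y + s *\<^sub>R e)) has_vector_derivative H' (y + s *\<^sub>R e) e) (at s within {-1..1})"
      if "s \<in> {-1..1}" "y \<in> cbox a b" for s y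
    proof -
      have "y + s *\<^sub>R e \<in> S" using S[of y s] that by auto
      have "((\<lambda>s. y + s *\<^sub>R e) has_vector_derivative e) (at s)"
        by (auto intro!: derivative_eq_intros)
      from vector_derivative_diff_chain_within[OF has_vector_derivative_at_within[OF this]
          has_derivative_at_withinI[OF der[OF \<open>y + s *\<^sub>R e \<in> S\<close>]]]
      show ?thesis by (simp add: o_def)
    qed
    show "(\<lambda>y. H (y + s *\<^sub>R e)) integrable_on cbox a b" if "s \<in> {-1..1}" for s
      using that S by (intro integrable_continuous continuous_on_compose2[OF contH] continuous_intros) auto
    show "continuous_on ({-1..1} \<times> cbox a b) (\<lambda>(s, y). H' (y + s *\<^sub>R e) e)"
      using S unfolding case_prod_beta
      by (intro continuous_on_compose2[OF cont] continuous_intros) auto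
  qed auto
  then have "((\<lambda>s. integral (cbox a b) (\<lambda>y. H (y + s *\<^sub>R e)))
      has_vector_derivative integral (cbox a b) (\<lambda>y. H' y e)) (at 0 within {-1..1})"
    by simp
  then have "((\<lambda>s. integral (cball 0 1) H) has_vector_derivative integral (cbox a b) (\<lambda>y. H' y e)) (at 0 within {-1..1})"
    by (rule has_vector_derivative_transform[rotated 2]) (auto simp: shift)
  then have "((\<lambda>s. integral (cball 0 1) H) has_vector_derivative integral (cbox a b) (\<lambda>y. H' y e)) (at (0::real))"
    by (simp add: at_within_Icc_at)
  then show ?thesis
    using vector_derivative_unique_at has_vector_derivative_const by blast
qed

text \<open>
  The square makes the weight continuously differentiable across the unit sphere.
\<close>

definition bump :: "'a::real_inner \<Rightarrow> real" where
  "bump y = (max 0 (1 - y \<bullet> y))\<^sup>2"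

lemma bump_nonneg: "bump y \<ge> 0"
  by (simp add: bump_def)

lemma bump_eq_0: "norm y > 1 \<Longrightarrow> bump y = 0"
  unfolding bump_def by (smt (verit) dot_square_norm one_less_power pos2 power_zero_numeral)

lemma bump_pos: "norm y < 1 \<Longrightarrow> bump y > 0"
  using abs_square_less_1[of "norm y"] by (simp add: bump_def dot_square_norm)

lemma continuous_on_bump [continuous_intros]: "continuous_on S bump"
  unfolding bump_def by (intro continuous_intros)

lemma has_real_derivative_max_square:
  "((\<lambda>x::real. (max 0 x)\<^sup>2) has_real_derivative 2 * max 0 x) (at x)"
proof (cases x "0::real" rule: linorder_cases)
  case less
  have "((\<lambda>x::real. 0) has_real_derivative 2 * max 0 x) (at x)"
    using less by simp
  then show ?thesis
    by (rule has_field_derivative_transform_within_open[where S = "{..<0}"]) (use less in auto)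
next
  case greater
  have "((\<lambda>x::real. x\<^sup>2) has_real_derivative 2 * max 0 x) (at x)"
    using greater by (auto intro!: derivative_eq_intros)
  then show ?thesis
    by (rule has_field_derivative_transform_within_open[where S = "{0<..}"]) (use greater in auto)
next
  case equal
  have "(\<lambda>h::real. (max 0 h)\<^sup>2 / h) \<midarrow>0\<rightarrow> 0"
  proof (rule Lim_null_comparison)
    show "\<forall>\<^sub>F h::real in at 0. norm ((max 0 h)\<^sup>2 / h) \<le> \<bar>h\<bar>"
      by (intro always_eventually allI) (auto simp: max_def power2_eq_square)
    show "(\<lambda>h::real. \<bar>h\<bar>) \<midarrow>0\<rightarrow> 0" by (intro tendsto_eq_intros | simp)+
  qed
  then show ?thesis using equal by (simp add: DERIV_def)
qed

lemma has_derivative_bump: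
  "(bump has_derivative (\<lambda>h. - 4 * max 0 (1 - y \<bullet> y) * (y \<bullet> h))) (at y)"
proof -
  have "((\<lambda>x. 1 - x \<bullet> x) has_derivative (\<lambda>h. - (2 * (y \<bullet> h)))) (at y)"
    by (auto intro!: derivative_eq_intros simp: inner_commute)
  from has_derivative_compose[OF this has_real_derivative_max_square[unfolded has_field_derivative_def]]
  show ?thesis by (simp add: bump_def[abs_def] algebra_simps)
qed

text \<open>
  For a radial weight $\varphi$, the angular derivative
  $\langle y,e\rangle\,\partial_{e'} - \langle y,e'\rangle\,\partial_e$ annihilates $\varphi$, so its integral
  against $\varphi$ is a boundary term. In detail, integrating
  $\partial_{e'}(\varphi(y)\langle y,e\rangle G(y))$ turns the left-hand side into
  $-\int (\partial_{e'}\varphi)(y)\langle y,e\rangle G(y)\,dy$, which is symmetric in $e$ and $e'$ because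
  $\partial_{e'}\varphi$ is $\langle y,e'\rangle$ times a radial function.
\<close>

lemma bump_moment_symmetric:
  fixes G :: "'a::euclidean_space \<Rightarrow> 'b::euclidean_space"
  assumes Q: "cball 0 2 \<subseteq> cbox a b"
    and S: "\<And>y z. y \<in> cbox a b \<Longrightarrow> norm z \<le> 1 \<Longrightarrow> y + z \<in> S"
    and der: "\<And>y. y \<in> S \<Longrightarrow> (G has_derivative G' y) (at y)"
    and cont: "continuous_on S (\<lambda>y. G' y e)" "continuous_on S (\<lambda>y. G' y e')"
    and e: "norm e \<le> 1" "norm e' \<le> 1" "e \<bullet> e' = 0"
  shows "integral (cbox a b) (\<lambda>y. (bump y * (y \<bullet> e)) *\<^sub>R G' y e')
       = integral (cbox a b) (\<lambda>y. (bump y * (y \<bullet> e')) *\<^sub>R G' y e)"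
proof -
  have contG: "continuous_on S G"
    by (rule has_derivative_continuous_on[OF has_derivative_at_withinI[OF der]])
  have QS: "cbox a b \<subseteq> S" using S[of _ 0] by auto
  have half: "integral (cbox a b) (\<lambda>y. (bump y * (y \<bullet> e)) *\<^sub>R G' y e')
       = integral (cbox a b) (\<lambda>y. (4 * max 0 (1 - y \<bullet> y) * (y \<bullet> e) * (y \<bullet> e')) *\<^sub>R G y)"
    if cont': "continuous_on S (\<lambda>y. G' y e')" and ee: "e \<bullet> e' = 0" "norm e' \<le> 1" for e e'
  proof -
    define H where "H = (\<lambda>y. (bump y * (y \<bullet> e)) *\<^sub>R G y)"
    define H' where "H' y h = (bump y * (y \<bullet> e)) *\<^sub>R G' y h
        + (bump y * (h \<bullet> e) + - 4 * max 0 (1 - y \<bullet> y) * (y \<bullet> h) * (y \<bullet> e)) *\<^sub>R G y" for y h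
    have H'e': "H' y e' = (bump y * (y \<bullet> e)) *\<^sub>R G' y e'
        - (4 * max 0 (1 - y \<bullet> y) * (y \<bullet> e) * (y \<bullet> e')) *\<^sub>R G y" for y
      using ee(1) by (simp add: H'_def inner_commute algebra_simps)
    have "integral (cbox a b) (\<lambda>y. H' y e') = 0"
    proof (rule integral_directional_derivative_eq_0[OF Q ee(2)])
      show "y + s *\<^sub>R e' \<in> S" if "y \<in> cbox a b" "\<bar>s\<bar> \<le> 1" for y s
        using that ee(2) by (intro S) (auto intro: mult_le_one)
      show "(H has_derivative H' y) (at y)" if "y \<in> S" for y
      proof -
        have 1: "((\<lambda>y. y \<bullet> e) has_derivative (\<lambda>h. h \<bullet> e)) (at y)"
          by (auto intro!: derivative_eq_intros)
        show ?thesis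
          unfolding H_def H'_def
          by (rule has_derivative_scaleR[OF has_derivative_mult[OF has_derivative_bump 1] der[OF that]])
      qed
      show "continuous_on S (\<lambda>y. H' y e')"
        unfolding H'_def by (intro continuous_intros cont' contG)
      show "H y = 0" if "norm y > 1" for y
        using bump_eq_0[OF that] by (simp add: H_def)
    qed
    moreover have "integral (cbox a b) (\<lambda>y. H' y e') = integral (cbox a b) (\<lambda>y. (bump y * (y \<bullet> e)) *\<^sub>R G' y e')
      - integral (cbox a b) (\<lambda>y. (4 * max 0 (1 - y \<bullet> y) * (y \<bullet> e) * (y \<bullet> e')) *\<^sub>R G y)"
      unfolding H'e'
      by (intro integral_diff integrable_continuous continuous_intros
          continuous_on_subset[OF cont' QS] continuous_on_subset[OF contG QS])
    ultimately show ?thesis by simp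
  qed
  show ?thesis
    using half[OF cont(2) e(3,2)] half[OF cont(1) _ e(1), of e'] e(3)
    by (simp add: inner_commute mult_ac)
qed

section \<open>The mean value property of monogenic functions\<close>

text \<open>
  Off the diagonal the products $x^c y$ are antisymmetric by the Clifford relations, so they cancel
  against a symmetric array; on the diagonal they are $1$. The map \<open>cj\<close> stands for the conjugation $x \mapsto x^c$.
\<close>

lemma clifford_symmetric_contraction:
  fixes I :: "'a \<Rightarrow> 'a \<Rightarrow> 'a::{euclidean_space, real_algebra_1}"
  assumes "finite B"
    and clifford: "\<And>x y. x \<in> B \<Longrightarrow> y \<in> B \<Longrightarrow> cj x * y + cj y * x = of_real (2 * (x \<bullet> y))"
    and orth: "\<And>x y. x \<in> B \<Longrightarrow> y \<in> B \<Longrightarrow> x \<bullet> y = (if x = y then 1 else 0)"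
    and sym: "\<And>x y. x \<in> B \<Longrightarrow> y \<in> B \<Longrightarrow> x \<noteq> y \<Longrightarrow> I x y = I y x"
  shows "(\<Sum>x\<in>B. \<Sum>y\<in>B. cj x * y * I x y) = (\<Sum>x\<in>B. I x x)"
proof -
  let ?L = "\<Sum>x\<in>B. \<Sum>y\<in>B. cj x * y * I x y"
  have sym': "I x y = I y x" if "x \<in> B" "y \<in> B" for x y
    using sym[OF that] by (cases "x = y") auto
  have "?L = (\<Sum>x\<in>B. \<Sum>y\<in>B. cj y * x * I x y)"
    by (subst sum.swap) (intro sum.cong refl, simp add: sym')
  then have "2 *\<^sub>R ?L = (\<Sum>x\<in>B. \<Sum>y\<in>B. (cj x * y + cj y * x) * I x y)"
    by (simp add: sum.distrib distrib_right scaleR_2)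
  also have "\<dots> = (\<Sum>x\<in>B. \<Sum>y\<in>B. if x = y then 2 *\<^sub>R I x x else 0)"
    by (intro sum.cong refl) (simp add: clifford orth scaleR_conv_of_real)
  also have "\<dots> = 2 *\<^sub>R (\<Sum>x\<in>B. I x x)"
    using \<open>finite B\<close> by (simp add: sum.delta scaleR_sum_right)
  finally show ?thesis by simp
qed

text \<open>
  With $y^c = \sum_e \langle y,e\rangle e^c$, the equation $y^c \sum_e e\,\partial_e G = 0$, expanded
  and integrated against the weight, leaves only the radial derivative, since the off-diagonal moments
  are symmetric by \<open>bump_moment_symmetric\<close>.
\<close>

lemma monogenic_radial_integral_eq_0:
  fixes G :: "'a::{euclidean_space, real_algebra_1} \<Rightarrow> 'a"
  assumes Q: "cball 0 2 \<subseteq> cbox a b"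
    and S: "\<And>y z. y \<in> cbox a b \<Longrightarrow> norm z \<le> 1 \<Longrightarrow> y + z \<in> S"
    and B: "finite B"
    and clifford: "\<And>x y. x \<in> B \<Longrightarrow> y \<in> B \<Longrightarrow> cj x * y + cj y * x = of_real (2 * (x \<bullet> y))"
    and orth: "\<And>x y. x \<in> B \<Longrightarrow> y \<in> B \<Longrightarrow> x \<bullet> y = (if x = y then 1 else 0)"
    and der: "\<And>y. y \<in> S \<Longrightarrow> (G has_derivative G' y) (at y)"
    and cont: "\<And>e. e \<in> B \<Longrightarrow> continuous_on S (\<lambda>y. G' y e)"
    and dirac: "\<And>y. y \<in> S \<Longrightarrow> (\<Sum>e\<in>B. e * G' y e) = 0"
  shows "integral (cbox a b) (\<lambda>y. bump y *\<^sub>R (\<Sum>e\<in>B. (y \<bullet> e) *\<^sub>R G' y e)) = 0"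
proof -
  have QS: "cbox a b \<subseteq> S" using S[of _ 0] by auto
  define I where "I x y = integral (cbox a b) (\<lambda>z. (bump z * (z \<bullet> x)) *\<^sub>R G' z y)" for x y
  have norm_B: "norm e = 1" if "e \<in> B" for e
    using orth[OF that that] by (simp add: norm_eq_sqrt_inner)
  have int: "(\<lambda>z. (bump z * (z \<bullet> x)) *\<^sub>R G' z y) integrable_on cbox a b" if "y \<in> B" for x y
    by (intro integrable_continuous continuous_intros continuous_on_subset[OF cont[OF that] QS])
  have bl: "bounded_linear (\<lambda>u::'a. c * u)" for c
    by (simp add: linear_conv_bounded_linear[symmetric] linear_iff distrib_left)
  have "0 = integral (cbox a b) (\<lambda>z. \<Sum>x\<in>B. \<Sum>y\<in>B. cj x * y * ((bump z * (z \<bullet> x)) *\<^sub>R G' z y))"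
  proof -
    have "(\<Sum>x\<in>B. \<Sum>y\<in>B. cj x * y * ((bump z * (z \<bullet> x)) *\<^sub>R G' z y)) = 0" if "z \<in> cbox a b" for z
    proof -
      have "(\<Sum>x\<in>B. \<Sum>y\<in>B. cj x * y * ((bump z * (z \<bullet> x)) *\<^sub>R G' z y))
          = (\<Sum>x\<in>B. (bump z * (z \<bullet> x)) *\<^sub>R (cj x * (\<Sum>y\<in>B. y * G' z y)))"
        by (simp add: sum_distrib_left scaleR_sum_right mult.assoc)
      then show ?thesis using dirac that QS by auto
    qed
    then have "integral (cbox a b) (\<lambda>z. \<Sum>x\<in>B. \<Sum>y\<in>B. cj x * y * ((bump z * (z \<bullet> x)) *\<^sub>R G' z y))
        = integral (cbox a b) (\<lambda>z. 0)"
      by (intro integral_cong) auto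
    then show ?thesis by simp
  qed
  also have "\<dots> = (\<Sum>x\<in>B. \<Sum>y\<in>B. cj x * y * I x y)"
  proof -
    have int': "(\<lambda>z. cj x * y * ((bump z * (z \<bullet> x)) *\<^sub>R G' z y)) integrable_on cbox a b" if "y \<in> B" for x y
      using integrable_linear[OF int[OF that] bl] by (simp add: o_def)
    have eq: "integral (cbox a b) (\<lambda>z. cj x * y * ((bump z * (z \<bullet> x)) *\<^sub>R G' z y)) = cj x * y * I x y"
      if "y \<in> B" for x y
      using integral_linear[OF int[OF that] bl] by (simp add: o_def I_def)
    show ?thesis
      using B int' eq by (simp add: integral_sum integrable_sum)
  qed
  also have "\<dots> = (\<Sum>x\<in>B. I x x)"
  proof (rule clifford_symmetric_contraction[OF B clifford orth])
    show "I x y = I y x" if "x \<in> B" "y \<in> B" "x \<noteq> y" for x y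
      unfolding I_def
      by (rule bump_moment_symmetric[OF Q S der]) (use that cont norm_B orth in auto)
  qed
  also have "\<dots> = integral (cbox a b) (\<lambda>z. \<Sum>x\<in>B. (bump z * (z \<bullet> x)) *\<^sub>R G' z x)"
    unfolding I_def using B int by (simp add: integral_sum)
  also have "(\<lambda>z. \<Sum>x\<in>B. (bump z * (z \<bullet> x)) *\<^sub>R G' z x) = (\<lambda>z. bump z *\<^sub>R (\<Sum>x\<in>B. (z \<bullet> x) *\<^sub>R G' z x))"
    by (simp add: scaleR_sum_right)
  finally show ?thesis by simp
qed

text \<open>
  The derivative of $r \mapsto \int \varphi(y)\, g(p + r y)\,dy$ is the weighted integral of the radial
  derivative, and $r$ times this integral is the quantity of \<open>monogenic_radial_integral_eq_0\<close> for
  $y \mapsto g(p + r y)$.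
\<close>

lemma monogenic_weighted_mean:
  fixes g :: "'a::{euclidean_space, real_algebra_1} \<Rightarrow> 'a"
  assumes Q: "cball 0 2 \<subseteq> cbox a b" "cbox a b \<subseteq> cball 0 K"
    and U: "\<And>z r. norm z \<le> K + 1 \<Longrightarrow> 0 \<le> r \<Longrightarrow> r \<le> \<rho> \<Longrightarrow> p + r *\<^sub>R z \<in> U"
    and "0 \<le> \<rho>"
    and B: "finite B"
    and clifford: "\<And>x y. x \<in> B \<Longrightarrow> y \<in> B \<Longrightarrow> cj x * y + cj y * x = of_real (2 * (x \<bullet> y))"
    and orth: "\<And>x y. x \<in> B \<Longrightarrow> y \<in> B \<Longrightarrow> x \<bullet> y = (if x = y then 1 else 0)"
    and der: "\<And>x. x \<in> U \<Longrightarrow> (g has_derivative (\<lambda>h. \<Sum>e\<in>B. (h \<bullet> e) *\<^sub>R d e x)) (at x)"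
    and cont: "\<And>e. e \<in> B \<Longrightarrow> continuous_on U (d e)"
    and dirac: "\<And>x. x \<in> U \<Longrightarrow> (\<Sum>e\<in>B. e * d e x) = 0"
  shows "integral (cbox a b) (\<lambda>y. bump y *\<^sub>R g (p + \<rho> *\<^sub>R y)) = integral (cbox a b) (\<lambda>y. bump y *\<^sub>R g p)"
proof -
  have contg: "continuous_on U g"
    by (rule has_derivative_continuous_on[OF has_derivative_at_withinI[OF der]])
  have QU: "p + r *\<^sub>R (y + z) \<in> U" if "y \<in> cbox a b" "norm z \<le> 1" "r \<in> {0..\<rho>}" for y z r
  proof (rule U)
    have "norm y \<le> K" using that(1) Q(2) by auto
    then show "norm (y + z) \<le> K + 1" using that(2) norm_triangle_mono by blast
  qed (use that in auto)
  have QU0: "p + r *\<^sub>R y \<in> U" if "y \<in> cbox a b" "r \<in> {0..\<rho>}" for y r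
    using QU[of y 0 r] that by simp
  define M where "M r = integral (cbox a b) (\<lambda>y. bump y *\<^sub>R g (p + r *\<^sub>R y))" for r
  have M': "(M has_vector_derivative
      integral (cbox a b) (\<lambda>y. bump y *\<^sub>R (\<Sum>e\<in>B. (y \<bullet> e) *\<^sub>R d e (p + r *\<^sub>R y)))) (at r within {0..\<rho>})"
    if r: "r \<in> {0..\<rho>}" for r
    unfolding M_def[abs_def]
  proof (rule leibniz_rule_vector_derivative[OF _ _ _ r])
    show "((\<lambda>r. bump y *\<^sub>R g (p + r *\<^sub>R y)) has_vector_derivative
        bump y *\<^sub>R (\<Sum>e\<in>B. (y \<bullet> e) *\<^sub>R d e (p + r *\<^sub>R y))) (at r within {0..\<rho>})"
      if "r \<in> {0..\<rho>}" "y \<in> cbox a b" for r y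
    proof -
      have "((\<lambda>r. p + r *\<^sub>R y) has_vector_derivative y) (at r)"
        by (auto intro!: derivative_eq_intros)
      from vector_derivative_diff_chain_within[OF has_vector_derivative_at_within[OF this]
          has_derivative_at_withinI[OF der[OF QU0[OF that(2,1)]]]]
      have "((\<lambda>r. g (p + r *\<^sub>R y)) has_vector_derivative
          (\<Sum>e\<in>B. (y \<bullet> e) *\<^sub>R d e (p + r *\<^sub>R y))) (at r within {0..\<rho>})"
        by (simp add: o_def)
      then show ?thesis
        by (rule bounded_linear.has_vector_derivative[OF bounded_linear_scaleR_right])
    qed
    show "(\<lambda>y. bump y *\<^sub>R g (p + r *\<^sub>R y)) integrable_on cbox a b" if "r \<in> {0..\<rho>}" for r
      using QU0 that
      by (intro integrable_continuous continuous_intros continuous_on_compose2[OF contg]) auto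
    show "continuous_on ({0..\<rho>} \<times> cbox a b)
        (\<lambda>(r, y). bump y *\<^sub>R (\<Sum>e\<in>B. (y \<bullet> e) *\<^sub>R d e (p + r *\<^sub>R y)))"
      unfolding case_prod_beta
      by (intro continuous_intros continuous_on_compose2[OF cont]
          continuous_on_compose2[OF continuous_on_bump[of UNIV]])
         (auto intro!: QU0)
  qed auto
  \<comment> \<open>The rescaled function $y \mapsto g(p + r y)$ has derivative $r g'$, so the factor $r$ can be
      cancelled only for $r \neq 0$. The single point $r = 0$ does no harm: the mean is continuous
      there.\<close>
  have radial: "integral (cbox a b) (\<lambda>y. bump y *\<^sub>R (\<Sum>e\<in>B. (y \<bullet> e) *\<^sub>R d e (p + r *\<^sub>R y))) = 0"
    if r: "r \<in> {0..\<rho>} - {0}" for r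
  proof -
    define S where "S = {y. p + r *\<^sub>R y \<in> U}"
    define G' where "G' y h = r *\<^sub>R (\<Sum>e\<in>B. (h \<bullet> e) *\<^sub>R d e (p + r *\<^sub>R y))" for y h
    have G'e: "G' y e = r *\<^sub>R d e (p + r *\<^sub>R y)" if "e \<in> B" for y e
    proof -
      have "(\<Sum>e'\<in>B. (e \<bullet> e') *\<^sub>R d e' (p + r *\<^sub>R y)) = (\<Sum>e'\<in>B. if e = e' then d e' (p + r *\<^sub>R y) else 0)"
        using orth that by (intro sum.cong) auto
      then show ?thesis using B that by (simp add: G'_def)
    qed
    have "integral (cbox a b) (\<lambda>y. bump y *\<^sub>R (\<Sum>e\<in>B. (y \<bullet> e) *\<^sub>R G' y e)) = 0"
    proof (rule monogenic_radial_integral_eq_0[OF Q(1) _ B clifford orth])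
      show "y + z \<in> S" if "y \<in> cbox a b" "norm z \<le> 1" for y z
        using QU[OF that] r by (simp add: S_def)
      show "((\<lambda>y. g (p + r *\<^sub>R y)) has_derivative G' y) (at y)" if "y \<in> S" for y
      proof -
        have "((\<lambda>y. p + r *\<^sub>R y) has_derivative (\<lambda>h. r *\<^sub>R h)) (at y)"
          by (auto intro!: derivative_eq_intros)
        from has_derivative_compose[OF this der] that
        show ?thesis by (simp add: S_def G'_def[abs_def] scaleR_sum_right)
      qed
      show "continuous_on S (\<lambda>y. G' y e)" if "e \<in> B" for e
        unfolding G'e[OF that]
        by (intro continuous_intros continuous_on_compose2[OF cont[OF that]]) (auto simp: S_def)
      show "(\<Sum>e\<in>B. e * G' y e) = 0" if "y \<in> S" for y
      proof -
        have "(\<Sum>e\<in>B. e * G' y e) = r *\<^sub>R (\<Sum>e\<in>B. e * d e (p + r *\<^sub>R y))"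
          by (simp add: G'e scaleR_sum_right)
        then show ?thesis using dirac that by (simp add: S_def)
      qed
    qed
    moreover have "(\<lambda>y. bump y *\<^sub>R (\<Sum>e\<in>B. (y \<bullet> e) *\<^sub>R G' y e))
        = (\<lambda>y. r *\<^sub>R (bump y *\<^sub>R (\<Sum>e\<in>B. (y \<bullet> e) *\<^sub>R d e (p + r *\<^sub>R y))))"
      by (simp add: G'e scaleR_sum_right mult_ac)
    ultimately have "r *\<^sub>R integral (cbox a b) (\<lambda>y. bump y *\<^sub>R (\<Sum>e\<in>B. (y \<bullet> e) *\<^sub>R d e (p + r *\<^sub>R y))) = 0"
      by (simp only: integral_cmul)
    then show ?thesis using r by simp
  qed
  have "M \<rho> = M 0"
  proof (rule has_derivative_zero_unique_strong_convex[where f = M and c = 0 and K = "{0}" and S = "{0..\<rho>}"])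
    show "continuous_on {0..\<rho>} M"
      using M' unfolding has_vector_derivative_def by (rule has_derivative_continuous_on)
    show "(M has_derivative (\<lambda>h. 0)) (at r within {0..\<rho>})" if "r \<in> {0..\<rho>} - {0}" for r
      using M'[of r] radial[OF that] that by (simp add: has_vector_derivative_def)
  qed (use \<open>0 \<le> \<rho>\<close> in auto)
  then show ?thesis by (simp add: M_def)
qed

section \<open>The maximum principle on one slice\<close>

text \<open>
  With $c = g(p)$, maximality gives $\langle c, c - g\rangle \ge 0$, and the mean value property gives
  this function weighted mean zero, so $\langle c, g\rangle = \|c\|^2$ on a ball. Then
  $\|g - c\|^2 = \|g\|^2 - \|c\|^2 \le 0$.
\<close>

lemma monogenic_max_locally_constant:
  fixes g :: "'a::{euclidean_space, real_algebra_1} \<Rightarrow> 'a"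
  assumes U: "open U" "p \<in> U"
    and B: "finite B"
    and clifford: "\<And>x y. x \<in> B \<Longrightarrow> y \<in> B \<Longrightarrow> cj x * y + cj y * x = of_real (2 * (x \<bullet> y))"
    and orth: "\<And>x y. x \<in> B \<Longrightarrow> y \<in> B \<Longrightarrow> x \<bullet> y = (if x = y then 1 else 0)"
    and der: "\<And>x. x \<in> U \<Longrightarrow> (g has_derivative (\<lambda>h. \<Sum>e\<in>B. (h \<bullet> e) *\<^sub>R d e x)) (at x)"
    and cont: "\<And>e. e \<in> B \<Longrightarrow> continuous_on U (d e)"
    and dirac: "\<And>x. x \<in> U \<Longrightarrow> (\<Sum>e\<in>B. e * d e x) = 0"
    and max: "\<And>x. x \<in> U \<Longrightarrow> norm (g x) \<le> norm (g p)"
  shows "\<exists>\<delta>>0. \<forall>x\<in>ball p \<delta>. g x = g p"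
proof -
  define c where "c = g p"
  define a b :: 'a where "a = - 2 *\<^sub>R One" and "b = 2 *\<^sub>R One"
  have contg: "continuous_on U g"
    by (rule has_derivative_continuous_on[OF has_derivative_at_withinI[OF der]])
  have Q: "cball 0 2 \<subseteq> cbox a b"
  proof
    fix y :: 'a assume "y \<in> cball 0 2"
    then have "\<bar>y \<bullet> i\<bar> \<le> 2" if "i \<in> Basis" for i
      using Basis_le_norm[OF that, of y] by simp
    then show "y \<in> cbox a b"
      by (auto simp: a_def b_def mem_box abs_le_iff minus_le_iff)
  qed
  obtain K where K: "K > 0" "cbox a b \<subseteq> cball 0 K"
  proof -
    obtain K where "K > 0" "\<forall>x\<in>cbox a b. norm x \<le> K"
      using bounded_cbox[of a b] unfolding bounded_pos by blast
    then show ?thesis by (intro that[of K]) auto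
  qed
  obtain \<epsilon> where \<epsilon>: "\<epsilon> > 0" "ball p \<epsilon> \<subseteq> U" using U openE by blast
  \<comment> \<open>Points $y$ of the box have norm at most $K$, and a unit of room is left for
      translations; thus the scale must satisfy $\rho (K + 1) < \epsilon$.\<close>
  define \<rho> where "\<rho> = \<epsilon> / (K + 2)"
  have "\<rho> > 0" using \<epsilon> K by (simp add: \<rho>_def)
  have inU: "p + r *\<^sub>R z \<in> U" if "norm z \<le> K + 1" "0 \<le> r" "r \<le> \<rho>" for z r
  proof -
    have "norm (r *\<^sub>R z) \<le> \<rho> * (K + 1)"
      using that by (auto intro!: mult_mono)
    also have "\<dots> < \<epsilon>" using \<epsilon> K by (simp add: \<rho>_def field_simps)
    finally show ?thesis using \<epsilon>(2) by (auto simp: dist_norm)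
  qed
  have QU: "p + \<rho> *\<^sub>R y \<in> U" if "y \<in> cbox a b" for y
    using that K \<open>\<rho> > 0\<close> by (intro inU) auto
  have contgQ: "continuous_on (cbox a b) (\<lambda>y. g (p + \<rho> *\<^sub>R y))"
    using QU by (intro continuous_on_compose2[OF contg] continuous_intros) auto
  have nonneg: "0 \<le> c \<bullet> (c - g x)" if "x \<in> U" for x
  proof -
    have "c \<bullet> g x \<le> norm c * norm (g x)" by (rule norm_cauchy_schwarz)
    also have "\<dots> \<le> norm c * norm c" using max[OF that] by (simp add: c_def mult_left_mono)
    finally show ?thesis by (simp add: inner_diff_right dot_square_norm power2_eq_square)
  qed
  define u where "u y = c \<bullet> (bump y *\<^sub>R c - bump y *\<^sub>R g (p + \<rho> *\<^sub>R y))" for y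
  have u_eq: "u y = bump y * (c \<bullet> (c - g (p + \<rho> *\<^sub>R y)))" for y
    by (simp add: u_def inner_diff_right algebra_simps)
  have "integral (cbox a b) u = 0"
  proof -
    have 1: "(\<lambda>y. bump y *\<^sub>R c) integrable_on cbox a b"
      by (intro integrable_continuous continuous_intros)
    have 2: "(\<lambda>y. bump y *\<^sub>R g (p + \<rho> *\<^sub>R y)) integrable_on cbox a b"
      by (intro integrable_continuous continuous_intros contgQ)
    have "integral (cbox a b) u
        = c \<bullet> integral (cbox a b) (\<lambda>y. bump y *\<^sub>R c - bump y *\<^sub>R g (p + \<rho> *\<^sub>R y))"
      using integral_linear[OF integrable_diff[OF 1 2] bounded_linear_inner_right[of c]]
      by (simp add: o_def u_def[abs_def])
    also have "\<dots> = c \<bullet> (integral (cbox a b) (\<lambda>y. bump y *\<^sub>R c)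
        - integral (cbox a b) (\<lambda>y. bump y *\<^sub>R g (p + \<rho> *\<^sub>R y)))"
      by (simp add: integral_diff[OF 1 2])
    also have "\<dots> = 0"
      using monogenic_weighted_mean[OF Q K(2) inU _ B clifford orth der cont dirac] \<open>\<rho> > 0\<close>
      by (simp add: c_def)
    finally show ?thesis .
  qed
  moreover have "continuous_on (cbox a b) u"
    unfolding u_def by (intro continuous_intros contgQ)
  moreover have "box a b \<noteq> {}"
    by (simp add: a_def b_def box_ne_empty)
  moreover have "u y \<ge> 0" if "y \<in> cbox a b" for y
    unfolding u_eq using nonneg[OF QU[OF that]] bump_nonneg by (intro mult_nonneg_nonneg)
  ultimately have u0: "u y = 0" if "y \<in> cbox a b" for y
    using integral_cbox_eq_0_iff[of a b u] that by blast
  have "g x = c" if x: "x \<in> ball p \<rho>" for x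
  proof -
    define y where "y = (x - p) /\<^sub>R \<rho>"
    have y: "norm y < 1" "x = p + \<rho> *\<^sub>R y"
      using x \<open>\<rho> > 0\<close> by (auto simp: y_def dist_norm norm_minus_commute divide_simps)
    then have yQ: "y \<in> cbox a b" using Q by auto
    have "c \<bullet> (c - g x) = 0"
      using u0[OF yQ] bump_pos[OF y(1)] by (simp add: u_eq y(2))
    then have "(norm (g x - c))\<^sup>2 = (norm (g x))\<^sup>2 - (norm c)\<^sup>2"
      by (simp add: power2_norm_eq_inner algebra_simps inner_commute)
    also have "\<dots> \<le> 0"
      using max QU[OF yQ] y(2) by (simp add: c_def power_mono)
    finally show ?thesis by simp
  qed
  then show ?thesis using \<open>\<rho> > 0\<close> c_def by blast
qed

lemma orthonormal_expansion:
  assumes B: "finite B" and orth: "\<And>x y. x \<in> B \<Longrightarrow> y \<in> B \<Longrightarrow> x \<bullet> y = (if x = y then 1 else 0)"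
    and "x \<in> span B"
  shows "(\<Sum>e\<in>B. (x \<bullet> e) *\<^sub>R e) = x"
proof -
  have "(\<Sum>e\<in>B. (x \<bullet> e) *\<^sub>R e) = id x"
  proof (rule linear_eq_on_span[OF _ linear_id _ \<open>x \<in> span B\<close>])
    show "linear (\<lambda>x. \<Sum>e\<in>B. (x \<bullet> e) *\<^sub>R e)"
      by (intro bounded_linear.linear bounded_linear_intros)
    fix x assume "x \<in> B"
    then have "(\<Sum>e\<in>B. (x \<bullet> e) *\<^sub>R e) = (\<Sum>e\<in>B. if x = e then e else 0)"
      using orth by (intro sum.cong) auto
    then show "(\<Sum>e\<in>B. (x \<bullet> e) *\<^sub>R e) = id x"
      using B \<open>x \<in> B\<close> by simp
  qed
  then show ?thesis by simp
qed

text \<open>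
  The set where $f$ attains the value $f(p)$ is closed in $Y$, and it is open since each of its points is
  again a maximum point. The local statement is applied to $f \circ P$ on $P^{-1}(Y)$, where $P$ is the
  orthogonal projection onto the span of $B$.
\<close>

lemma monogenic_maximum_principle:
  fixes f :: "'a::{euclidean_space, real_algebra_1} \<Rightarrow> 'a"
  assumes B: "finite B"
    and clifford: "\<And>x y. x \<in> B \<Longrightarrow> y \<in> B \<Longrightarrow> cj x * y + cj y * x = of_real (2 * (x \<bullet> y))"
    and orth: "\<And>x y. x \<in> B \<Longrightarrow> y \<in> B \<Longrightarrow> x \<bullet> y = (if x = y then 1 else 0)"
    and Y: "openin (top_of_set (span B)) Y" "connected Y" "p \<in> Y"
    and C1: "class_C1_on B f Y"
    and dirac: "\<And>x. x \<in> Y \<Longrightarrow> (\<Sum>e\<in>B. e * partial_deriv e f x) = 0"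
    and max: "\<And>x. x \<in> Y \<Longrightarrow> norm (f x) \<le> norm (f p)"
    and "x \<in> Y"
  shows "f x = f p"
proof -
  define P where "P x = (\<Sum>e\<in>B. (x \<bullet> e) *\<^sub>R e)" for x
  have linP: "linear P"
    unfolding P_def[abs_def] by (intro bounded_linear.linear bounded_linear_intros)
  have contP: "continuous_on S P" for S
    unfolding P_def[abs_def] by (intro continuous_intros)
  have P_span: "P x \<in> span B" for x
    unfolding P_def by (intro span_sum span_scale span_base)
  have P_id: "P x = x" if "x \<in> span B" for x
    unfolding P_def by (rule orthonormal_expansion[OF B orth that])
  have norm_B: "norm e = 1" if "e \<in> B" for e
    using orth[OF that that] by (simp add: norm_eq_sqrt_inner)
  have Y_span: "Y \<subseteq> span B" using Y(1) by (rule openin_imp_subset)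
  define g where "g x = f (P x)" for x
  define d where "d e x = partial_deriv e f (P x)" for e x
  define U where "U = P -` Y"
  have YU: "Y \<subseteq> U" using Y_span P_id by (auto simp: U_def)
  have openU: "open U"
  proof -
    obtain T where T: "open T" "Y = span B \<inter> T" using Y(1) by (auto simp: openin_open)
    have "U = P -` T" using T(2) P_span by (auto simp: U_def)
    then show ?thesis using open_vimage[OF T(1) contP] by simp
  qed
  have P_add: "P (y + s *\<^sub>R e) = P y + s *\<^sub>R e" if "e \<in> B" for y s e
    using P_id[OF span_base[OF that]] by (simp add: linear_add[OF linP] linear_scale[OF linP])
  have cont: "continuous_on U (d e)" if "e \<in> B" for e
    unfolding d_def using C1 that
    by (intro continuous_on_compose2[OF _ contP]) (auto simp: class_C1_on_def U_def)
  have der: "(g has_derivative (\<lambda>h. \<Sum>e\<in>B. (h \<bullet> e) *\<^sub>R d e x)) (at x)" if "x \<in> U" for x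
  proof (rule has_derivative_of_continuous_partials[OF B norm_B openU that _ cont])
    show "((\<lambda>s. g (y + s *\<^sub>R e)) has_vector_derivative d e y) (at 0)" if "e \<in> B" "y \<in> U" for e y
      using C1 that
      by (auto simp: g_def d_def P_add class_C1_on_def U_def partial_deriv_def vector_derivative_works[symmetric])
    show "g (x + h) = g (x + (\<Sum>e\<in>B. (h \<bullet> e) *\<^sub>R e))" for h
      using P_id[OF P_span] by (simp add: g_def linear_add[OF linP] P_def[symmetric])
  qed
  have gf: "g x = f x" if "x \<in> Y" for x using that Y_span P_id by (auto simp: g_def)
  have contf: "continuous_on Y f"
  proof -
    have "continuous_on U g"
      by (rule has_derivative_continuous_on[OF has_derivative_at_withinI[OF der]])
    then show ?thesis using continuous_on_subset[OF _ YU] gf by (metis continuous_on_cong)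
  qed
  let ?Z = "{x \<in> Y. f x = f p}"
  have "closedin (top_of_set Y) ?Z"
    by (rule continuous_closedin_preimage_constant[OF contf])
  moreover have "openin (top_of_set Y) ?Z"
    unfolding openin_contains_ball
  proof (intro conjI ballI)
    fix q assume q: "q \<in> ?Z"
    have "\<exists>\<delta>>0. \<forall>x\<in>ball q \<delta>. g x = g q"
    proof (rule monogenic_max_locally_constant[OF openU _ B clifford orth der cont])
      show "q \<in> U" using q YU by auto
      show "(\<Sum>e\<in>B. e * d e x) = 0" if "x \<in> U" for x
        using dirac that by (simp add: d_def U_def)
      show "norm (g x) \<le> norm (g q)" if "x \<in> U" for x
        using max that q gf by (simp add: g_def[of x] U_def)
    qed
    then obtain \<delta> where "\<delta> > 0" "\<forall>x\<in>ball q \<delta>. g x = g q" by blast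
    then show "\<exists>\<delta>>0. ball q \<delta> \<inter> Y \<subseteq> ?Z"
      using q gf by (intro exI[of _ \<delta>]) auto
  qed auto
  ultimately have "?Z = {} \<or> ?Z = Y"
    using Y(2) unfolding connected_clopen by blast
  then show ?thesis using Y(3) \<open>x \<in> Y\<close> by blast
qed

section \<open>Slices and their orthonormal bases\<close>

lemma star_involution_one:
  assumes "star_involution star"
  shows "star 1 = 1"
proof -
  have "star (star 1 * 1) = star 1 * star (star 1)" "star (star 1) = 1"
    using assms unfolding star_involution_def by blast+
  then show ?thesis by simp
qed

text \<open>
  Both sides are bilinear, so the identity need only be checked on the hypercomplex basis, where it
  expresses $v_s^c = -v_s$, $v_s^2 = -1$ and anticommutativity; the scalar product enters through
  orthonormality of that basis. In bilinear form the identity is independent of the basis, so it applies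
  at once to every slice basis.
\<close>

lemma hypercomplex_clifford:
  assumes star: "star_involution star"
    and basis: "hypercomplex_basis star V n v"
    and orth: "orthonormal_family d v" "n \<le> d"
    and xy: "x \<in> V" "y \<in> V"
  shows "star x * y + star y * x = of_real (2 * (x \<bullet> y))"
proof -
  have lin: "linear star" using star by (simp add: star_involution_def)
  have v0: "v 0 = 1" and span: "span (v ` {..n}) = V"
    using basis by (simp_all add: hypercomplex_basis_def ordered_basis_def)
  have unit: "v s \<in> imag_units star" if "s \<in> {1..n}" for s
    using basis that unfolding hypercomplex_basis_def by blast
  have anti: "v s * v u = - (v u * v s)" if "s \<in> {1..n}" "u \<in> {1..n}" "s \<noteq> u" for s u
    using basis that unfolding hypercomplex_basis_def by blast
  have star_v: "star (v s) = - v s" if "s \<in> {1..n}" for s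
    using unit[OF that] minus_unique[of "v s" "star (v s)"]
    by (simp add: imag_units_def trace_A_def)
  have sq: "v s * v s = - 1" if "s \<in> {1..n}" for s
    using unit[OF that] star_v[OF that] by (simp add: imag_units_def norm_A_def minus_equation_iff)
  define \<beta> where "\<beta> x y = star x * y + star y * x - of_real (2 * (x \<bullet> y))" for x y
  have \<beta>_comm: "\<beta> x y = \<beta> y x" for x y by (simp add: \<beta>_def inner_commute add.commute)
  have lin\<beta>: "linear (\<beta> x)" for x
  proof (rule linearI)
    show "\<beta> x (y + z) = \<beta> x y + \<beta> x z" for y z
      by (simp add: \<beta>_def linear_add[OF lin] algebra_simps)
    show "\<beta> x (r *\<^sub>R y) = r *\<^sub>R \<beta> x y" for r y
    proof -
      have "2 * (x \<bullet> r *\<^sub>R y) = r * (2 * (x \<bullet> y))"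
        by simp
      then have "of_real (2 * (x \<bullet> r *\<^sub>R y)) = r *\<^sub>R (of_real (2 * (x \<bullet> y)) :: 'a)"
        by (simp only: scaleR_conv_of_real of_real_mult)
      then show ?thesis
        by (simp only: \<beta>_def linear_scale[OF lin] mult_scaleR_left mult_scaleR_right
            scaleR_add_right scaleR_diff_right)
    qed
  qed
  have basis0: "\<beta> (v i) (v j) = 0" if le: "i \<le> n" "j \<le> n" for i j
  proof -
    have ij: "v i \<bullet> v j = (if i = j then 1 else 0)"
      using orth that by (auto simp: orthonormal_family_def)
    have "i = 0 \<or> i \<in> {1..n}" "j = 0 \<or> j \<in> {1..n}" using le by auto
    then consider "i = 0" "j = 0" | "i = 0" "j \<in> {1..n}" | "i \<in> {1..n}" "j = 0"
      | "i \<in> {1..n}" "j \<in> {1..n}" "i = j" | "i \<in> {1..n}" "j \<in> {1..n}" "i \<noteq> j" by blast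
    then show ?thesis
    proof cases
      case 1
      then show ?thesis using ij by (simp add: \<beta>_def v0 star_involution_one[OF star])
    next
      case 2
      then show ?thesis using ij star_v by (simp add: \<beta>_def v0 star_involution_one[OF star])
    next
      case 3
      then show ?thesis using ij star_v by (simp add: \<beta>_def v0 star_involution_one[OF star])
    next
      case 4
      then show ?thesis using ij star_v[of j] sq[of j] by (simp add: \<beta>_def)
    next
      case 5
      then show ?thesis using ij star_v[of i] star_v[of j] anti[of i j] by (simp add: \<beta>_def)
    qed
  qed
  have "\<beta> (v i) y = 0" if "i \<le> n" for i
  proof (rule linear_eq_0_on_span[OF lin\<beta>])
    show "y \<in> span (v ` {..n})" using xy span by simp
    show "\<beta> (v i) z = 0" if "z \<in> v ` {..n}" for z using that basis0 \<open>i \<le> n\<close> by auto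
  qed
  then have \<beta>v: "\<beta> y (v i) = 0" if "i \<le> n" for i
    using that \<beta>_comm[of y "v i"] by simp
  have "\<beta> y x = 0"
  proof (rule linear_eq_0_on_span[OF lin\<beta>])
    show "x \<in> span (v ` {..n})" using xy span by simp
    show "\<beta> y z = 0" if "z \<in> v ` {..n}" for z using that \<beta>v by auto
  qed
  then have "\<beta> x y = 0" by (simp only: \<beta>_comm[of x y])
  then show ?thesis by (simp add: \<beta>_def)
qed

lemma orthonormal_family_span_inner_eq_0:
  assumes orth: "orthonormal_family d v" and I: "I \<subseteq> {..d}" "I' \<subseteq> {..d}" "I \<inter> I' = {}"
    and x: "x \<in> span (v ` I)" and y: "y \<in> span (v ` I')"
  shows "x \<bullet> y = 0"
proof -
  have "orthogonal x' y" if "x' \<in> v ` I" for x'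
  proof (rule orthogonal_to_span[OF y])
    fix y' assume "y' \<in> v ` I'"
    then obtain i j where ij: "i \<in> I" "x' = v i" "j \<in> I'" "y' = v j" using \<open>x' \<in> v ` I\<close> by auto
    then have "i \<noteq> j" "i \<le> d" "j \<le> d" using I by auto
    then show "orthogonal x' y'"
      using orth by (simp add: orthonormal_family_def orthogonal_def ij)
  qed
  then have "orthogonal y x"
    by (intro orthogonal_to_span[OF x]) (simp add: orthogonal_commute)
  then show ?thesis by (simp add: orthogonal_def inner_commute)
qed

lemma list_of_steps_mono:
  assumes "list_of_steps n \<tau> t" "h \<le> k" "k \<le> \<tau>"
  shows "t h \<le> t k"
  using assms unfolding list_of_steps_def
  by (metis atMost_iff le_trans order.strict_implies_order order_le_less strict_mono_onD)

text \<open>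
  The vectors $J_h$ lie in spans of pairwise disjoint blocks of basis vectors, all disjoint from the
  block of the mirror. In particular no vector is repeated in the family, so that sums over the
  indices can be replaced by sums over the set.
\<close>

lemma slice_basis_orthonormal:
  assumes orth: "orthonormal_family d v" "n \<le> d"
    and steps: "list_of_steps n \<tau> t" and J: "J \<in> torus v \<tau> t"
  shows "slice_basis v \<tau> t J \<subseteq> span (v ` {..n})"
    and "\<And>x y. x \<in> slice_basis v \<tau> t J \<Longrightarrow> y \<in> slice_basis v \<tau> t J \<Longrightarrow> x \<bullet> y = (if x = y then 1 else 0)"
    and "inj_on v {0..t 0}" "inj_on J {1..\<tau>}" "v ` {0..t 0} \<inter> J ` {1..\<tau>} = {}"
proof -
  have tn: "t h \<le> n" if "h \<le> \<tau>" for h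
    using list_of_steps_mono[OF steps that] steps by (simp add: list_of_steps_def)
  have Jspan: "J h \<in> span (v ` {t (h - 1) + 1..t h})" and Jnorm: "J h \<bullet> J h = 1" if "h \<in> {1..\<tau>}" for h
  proof -
    have "J h \<in> coord_sphere v (t (h - 1) + 1) (t h)" using J that by (auto simp: torus_def)
    then show "J h \<in> span (v ` {t (h - 1) + 1..t h})" "J h \<bullet> J h = 1"
      by (auto simp: coord_sphere_def coord_span_def norm_eq_1)
  qed
  have vv: "v i \<bullet> v j = (if i = j then 1 else 0)" if "i \<in> {0..t 0}" "j \<in> {0..t 0}" for i j
    using that orth tn[of 0] by (auto simp: orthonormal_family_def)
  have vJ: "v i \<bullet> J h = 0" if "i \<in> {0..t 0}" "h \<in> {1..\<tau>}" for i h
  proof (rule orthonormal_family_span_inner_eq_0[OF orth(1) _ _ _ _ Jspan[OF that(2)]])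
    show "v i \<in> span (v ` {0..t 0})" using that by (auto intro: span_base)
    have "t 0 \<le> t (h - 1)" using that by (intro list_of_steps_mono[OF steps]) auto
    then show "{0..t 0} \<inter> {t (h - 1) + 1..t h} = {}" by auto
    show "{0..t 0} \<subseteq> {..d}" "{t (h - 1) + 1..t h} \<subseteq> {..d}"
      using tn[of 0] tn[of h] that orth(2) by auto
  qed
  have JJ': "J h \<bullet> J k = 0" if "h \<in> {1..\<tau>}" "k \<in> {1..\<tau>}" "h < k" for h k
  proof (rule orthonormal_family_span_inner_eq_0[OF orth(1) _ _ _ Jspan[OF that(1)] Jspan[OF that(2)]])
    have "t h \<le> t (k - 1)" using that by (intro list_of_steps_mono[OF steps]) auto
    then show "{t (h - 1) + 1..t h} \<inter> {t (k - 1) + 1..t k} = {}" by auto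
    show "{t (h - 1) + 1..t h} \<subseteq> {..d}" "{t (k - 1) + 1..t k} \<subseteq> {..d}"
      using tn[of h] tn[of k] that orth(2) by auto
  qed
  have JJ: "J h \<bullet> J k = (if h = k then 1 else 0)" if "h \<in> {1..\<tau>}" "k \<in> {1..\<tau>}" for h k
    using JJ'[of h k] JJ'[of k h] Jnorm that by (cases h k rule: linorder_cases) (auto simp: inner_commute)
  show "slice_basis v \<tau> t J \<subseteq> span (v ` {..n})"
  proof
    fix x assume "x \<in> slice_basis v \<tau> t J"
    then consider i where "i \<in> {0..t 0}" "x = v i" | h where "h \<in> {1..\<tau>}" "x = J h"
      by (auto simp: slice_basis_def)
    then show "x \<in> span (v ` {..n})"
    proof cases
      case 1 then show ?thesis using tn[of 0] by (auto intro!: span_base)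
    next
      case 2
      have "v ` {t (h - 1) + 1..t h} \<subseteq> v ` {..n}" using tn[of h] 2 by auto
      from span_mono[OF this] show ?thesis using Jspan[OF 2(1)] 2(2) by auto
    qed
  qed
  show "x \<bullet> y = (if x = y then 1 else 0)" if "x \<in> slice_basis v \<tau> t J" "y \<in> slice_basis v \<tau> t J" for x y
    using that vv vJ JJ unfolding slice_basis_def
    by (auto simp: inner_commute split: if_splits)
  show "inj_on v {0..t 0}" using vv by (metis inj_onI zero_neq_one)
  show "inj_on J {1..\<tau>}" using JJ by (metis inj_onI zero_neq_one)
  show "v ` {0..t 0} \<inter> J ` {1..\<tau>} = {}" using vJ JJ by force
qed

lemma dbar_eq_sum_slice_basis:
  assumes "orthonormal_family d v" "n \<le> d" "list_of_steps n \<tau> t" "J \<in> torus v \<tau> t"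
  shows "dbar v \<tau> t J f p = (\<Sum>e\<in>slice_basis v \<tau> t J. e * partial_deriv e f p)"
  using slice_basis_orthonormal(3-5)[OF assms]
  by (simp add: dbar_def slice_basis_def sum.union_disjoint sum.reindex)

text \<open>
  Normalise the component $w_h$ of $x$ in each block to get $J_h$. If $w_h = 0$, any unit vector of the
  block will do; $v_{t_h}$ is available because the steps increase strictly.
\<close>

lemma exists_slice_through:
  assumes orth: "orthonormal_family d v" "n \<le> d"
    and steps: "list_of_steps n \<tau> t" and x: "x \<in> span (v ` {..n})"
  shows "\<exists>J\<in>torus v \<tau> t. x \<in> slice_space v \<tau> t J"
proof -
  have vv: "v i \<bullet> v j = (if i = j then 1 else 0)" if "i \<le> n" "j \<le> n" for i j
    using that orth by (auto simp: orthonormal_family_def)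
  have "inj_on v {..n}" using vv by (metis atMost_iff inj_onI zero_neq_one)
  moreover have "(\<Sum>e\<in>v ` {..n}. (x \<bullet> e) *\<^sub>R e) = x"
  proof (rule orthonormal_expansion[OF _ _ x])
    show "y \<bullet> z = (if y = z then 1 else 0)" if "y \<in> v ` {..n}" "z \<in> v ` {..n}" for y z
      using that vv by (auto split: if_splits)
  qed simp
  ultimately have expand: "x = (\<Sum>i\<le>n. (x \<bullet> v i) *\<^sub>R v i)"
    by (simp add: sum.reindex)
  define w where "w h = (\<Sum>i=t (h - 1) + 1..t h. (x \<bullet> v i) *\<^sub>R v i)" for h
  define J where "J = (\<lambda>h\<in>{1..\<tau>}. if w h = 0 then v (t h) else w h /\<^sub>R norm (w h))"
  have less: "t (h - 1) < t h" if "h \<in> {1..\<tau>}" for h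
    using steps that unfolding list_of_steps_def by (auto intro!: strict_mono_onD[of "{..\<tau>}" t])
  have tn: "t h \<le> n" if "h \<le> \<tau>" for h
    using list_of_steps_mono[OF steps that] steps by (simp add: list_of_steps_def)
  have w_span: "w h \<in> span (v ` {t (h - 1) + 1..t h})" for h
    unfolding w_def by (intro span_sum span_scale span_base) auto
  have "J h \<in> coord_sphere v (t (h - 1) + 1) (t h)" if h: "h \<in> {1..\<tau>}" for h
  proof (cases "w h = 0")
    case True
    have "norm (v (t h)) = 1" using vv[of "t h" "t h"] tn h by (simp add: norm_eq_1)
    then show ?thesis using True h less[OF h]
      by (auto simp: J_def coord_sphere_def coord_span_def intro!: span_base)
  next
    case False
    then show ?thesis using h w_span
      by (auto simp: J_def coord_sphere_def coord_span_def intro!: span_scale)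
  qed
  then have "J \<in> torus v \<tau> t" by (auto simp: torus_def J_def)
  moreover have "x \<in> slice_space v \<tau> t J"
  proof -
    have J_slice: "w h \<in> slice_space v \<tau> t J" if h: "h \<in> {1..\<tau>}" for h
    proof -
      have "w h = norm (w h) *\<^sub>R J h" using h by (simp add: J_def)
      moreover have "J h \<in> slice_space v \<tau> t J"
        unfolding slice_space_def slice_basis_def using h by (intro span_base) auto
      ultimately show ?thesis unfolding slice_space_def by (metis span_scale)
    qed
    have "(\<Sum>i\<le>t m. (x \<bullet> v i) *\<^sub>R v i) \<in> slice_space v \<tau> t J" if "m \<le> \<tau>" for m
      using that
    proof (induction m)
      case 0
      show ?case unfolding slice_space_def slice_basis_def
        by (intro span_sum span_scale span_base) auto
    next
      case (Suc m)
      have "{..t (Suc m)} = {..t m} \<union> {t m + 1..t (Suc m)}"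
        using less[of "Suc m"] Suc.prems by auto
      then have "(\<Sum>i\<le>t (Suc m). (x \<bullet> v i) *\<^sub>R v i) = (\<Sum>i\<le>t m. (x \<bullet> v i) *\<^sub>R v i) + w (Suc m)"
        by (simp add: w_def) (subst sum.union_disjoint, auto)
      then show ?case using Suc J_slice[of "Suc m"] by (auto simp: slice_space_def intro!: span_add)
    qed
    from this[of \<tau>] show ?thesis using steps expand by (simp add: list_of_steps_def)
  qed
  ultimately show ?thesis by blast
qed

section \<open>Constancy on the whole domain\<close>

theorem proposition7p4:
  fixes star :: "'a::{euclidean_space, real_algebra_1} \<Rightarrow> 'a"
    and V \<Omega> :: "'a set"
    and v :: "nat \<Rightarrow> 'a"
    and n d \<tau> :: nat
    and t :: "nat \<Rightarrow> nat"
    and f :: "'a \<Rightarrow> 'a"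
  assumes "star_involution star"
    and "imag_units star \<noteq> {}"
    and "hypercomplex_subspace star V"
    and "hypercomplex_basis star V n v"
    and "n \<le> d"
    and "ordered_basis UNIV d v"
    and "orthonormal_family d v"
    and "list_of_steps n \<tau> t"
    and "T_slice_domain V v \<tau> t \<Omega>"
    and "T_regular v \<tau> t \<Omega> f"
    and "\<exists>p\<in>\<Omega>. \<forall>x\<in>\<Omega>. norm (f x) \<le> norm (f p)"
  shows "f constant_on \<Omega>"
proof -
  note star = assms(1) and basis = assms(4) and nd = assms(5) and orth = assms(7) and steps = assms(8)
  have V: "span (v ` {..n}) = V"
    using basis by (simp add: hypercomplex_basis_def ordered_basis_def)
  have open\<Omega>: "openin (top_of_set V) \<Omega>"
    and conn: "\<And>J. J \<in> torus v \<tau> t \<Longrightarrow> connected (slice v \<tau> t \<Omega> J)"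
    using assms(9) by (auto simp: T_slice_domain_def domain_in_def)
  obtain m where m: "m \<in> \<Omega>" "m \<in> mirror v t"
    using assms(9) by (auto simp: T_slice_domain_def)
  obtain p where p: "p \<in> \<Omega>" and max: "\<And>x. x \<in> \<Omega> \<Longrightarrow> norm (f x) \<le> norm (f p)"
    using assms(11) by blast
  have slice_const: "f x = f q"
    if J: "J \<in> torus v \<tau> t" and q: "q \<in> slice v \<tau> t \<Omega> J" "norm (f q) = norm (f p)"
      and x: "x \<in> slice v \<tau> t \<Omega> J" for J q x
  proof -
    let ?B = "slice_basis v \<tau> t J"
    have reg: "monogenic_on v \<tau> t J f (slice v \<tau> t \<Omega> J)"
      using assms(10) J by (simp add: T_regular_def)
    have BV: "?B \<subseteq> V"
      using slice_basis_orthonormal(1)[OF orth nd steps J] V by simp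
    show ?thesis
    proof (rule monogenic_maximum_principle[where f = f and p = q and x = x
          and B = ?B and cj = star and Y = "slice v \<tau> t \<Omega> J"])
      show "finite ?B" by (simp add: slice_basis_def)
      show "star y * z + star z * y = of_real (2 * (y \<bullet> z))" if "y \<in> ?B" "z \<in> ?B" for y z
        using hypercomplex_clifford[OF star basis orth nd] BV that by blast
      show "y \<bullet> z = (if y = z then 1 else 0)" if "y \<in> ?B" "z \<in> ?B" for y z
        by (rule slice_basis_orthonormal(2)[OF orth nd steps J that])
      show "openin (top_of_set (span ?B)) (slice v \<tau> t \<Omega> J)"
      proof -
        obtain T where T: "open T" "\<Omega> = V \<inter> T" using open\<Omega> by (auto simp: openin_open)
        have "span ?B \<subseteq> V" using BV V by (metis span_minimal subspace_span)
        then have "slice v \<tau> t \<Omega> J = span ?B \<inter> T"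
          using T(2) by (auto simp: slice_def slice_space_def)
        then show ?thesis using T(1) by (auto simp: openin_open)
      qed
      show "class_C1_on ?B f (slice v \<tau> t \<Omega> J)" using reg by (simp add: monogenic_on_def)
      show "(\<Sum>e\<in>?B. e * partial_deriv e f y) = 0" if "y \<in> slice v \<tau> t \<Omega> J" for y
        using reg that dbar_eq_sum_slice_basis[OF orth nd steps J, of f y]
        by (simp add: monogenic_on_def)
      show "norm (f y) \<le> norm (f q)" if "y \<in> slice v \<tau> t \<Omega> J" for y
        using max[of y] that q(2) by (simp add: slice_def)
    qed (use conn[OF J] q x in auto)
  qed
  have m_slice: "m \<in> slice v \<tau> t \<Omega> J" for J
  proof -
    have "mirror v t \<subseteq> slice_space v \<tau> t J"
      unfolding mirror_def coord_span_def slice_space_def slice_basis_def by (intro span_mono) auto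
    then show ?thesis using m by (auto simp: slice_def)
  qed
  have through: "\<exists>J\<in>torus v \<tau> t. x \<in> slice v \<tau> t \<Omega> J" if "x \<in> \<Omega>" for x
    using exists_slice_through[OF orth nd steps, of x] V openin_imp_subset[OF open\<Omega>] that
    by (auto simp: slice_def)
  have "f m = f p"
    using through[OF p] slice_const m_slice by blast
  then have "f x = f m" if "x \<in> \<Omega>" for x
    using through[OF that] slice_const m_slice by metis
  then show ?thesis unfolding constant_on_def by blast
qed

end
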